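(* Consider a system of oblivious fully synchronous robots without chirality, and let $C_0$ be an initial configuration. If $C_0\in\mathcal C_\odot$, or if there exists an axis of symmetry of $C_0$ containing exactly one robot, then \textsc{Move-All} is not solvable in $2$ steps from $C_0$.
   Context: Model. There are $n\ge 2$ robots $r_0,\dots,r_{n-1}$, which are points in $\mathbb R^2$. A configuration is a tuple $C=(p_0,\dots,p_{n-1})$ of points, $p_i$ being the position of $r_i$ in a fixed global coordinate system unknown to the robots; an initial configuration consists of pairwise distinct points. Each robot $r_i$ has a local Cartesian coordinate system $Z_i$, always centred at its current position, whose orientation and unit length are fixed over time but arbitrary and possibly different for different robots. No chirality: the handedness of the $Z_i$ is also arbitrary and may differ between robots. Robots are anonymous, oblivious and deterministic: an algorithm $\mathcal A$ is one function, the same for all robots, mapping a snapshot (the multiset of positions of all robots expressed in the observing robot's local coordinate system, its own position being the origin) to a destination point (in the same local coordinates). In each round all robots simultaneously take a snapshot, compute their destination, and move exactly to it. Thus $C_0$ and $Z=(Z_0,\dots,Z_{n-1})$ determine the run $(C_0,C_1,C_2,\dots)$ of $\mathcal A$. Permutations. For a permutation $\pi$ of $\{0,\dots,n-1\}$ put $\pi(C)=(p_{\pi(0)},\dots,p_{\pi(n-1)})$. $\Pi_2$ is the set of permutations without fixed points. Problem. For $k\ge 1$, $\mathcal A$ solves \textsc{Move-All} in $k$ steps from $C_0$ if for every admissible $Z$ the run $(C_0,C_1,\dots)$ has the following property: for every $j\ge 0$ there is $\pi\in\Pi_2$ with $C_{j+ik}=\pi^i(C_j)$ for all $i\ge 0$.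 (As the robots are oblivious, every reached configuration $C_j$ counts as an initial configuration, from which the algorithm must also be correct.) The problem is solvable in $k$ steps from $C_0$ if some algorithm does this. $\mathcal C_\odot$ is the set of configurations $C$ having exactly one robot $r_c$ (the central robot) at the centre of the smallest circle enclosing $C$, and such that for some integer $k>1$ the rotation by $2\pi/k$ about the position of $r_c$ maps the multiset of points of $C$ to itself (so $n\ge 3$). An axis of symmetry of $C_0$ is a line such that reflection in it maps the set of points of $C_0$ to itself. *)

theory Defs
  imports "HOL-Analysis.Analysis" "HOL-Combinatorics.Permutations"
begin

text \<open>
  The Euclidean plane is \<^typ>\<open>complex\<close>, with its real inner product. A configuration of
  \<open>n\<close> robots is a list of length \<open>n\<close>; entry \<open>i\<close> is the position of robot \<open>i\<close>.
\<close>

type_synonym point = complex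
type_synonym configuration = "point list"

text \<open>
  A local coordinate system is given by the linear map sending local coordinates to the
  global displacement from the robot's current position: an isometry (of either handedness)
  scaled by the robot's unit length. Only the origin moves with the robot, so the map itself
  is constant over time.
\<close>

definition coordinate_system :: "(point \<Rightarrow> point) \<Rightarrow> bool" where
  "coordinate_system T \<longleftrightarrow>
     (\<exists>u>0. \<exists>Q. orthogonal_transformation Q \<and> T = (\<lambda>x. u *\<^sub>R Q x))"

definition to_local :: "(point \<Rightarrow> point) \<Rightarrow> point \<Rightarrow> point \<Rightarrow> point" where
  "to_local T p q = inv T (q - p)"

definition to_global :: "(point \<Rightarrow> point) \<Rightarrow> point \<Rightarrow> point \<Rightarrow> point" where
  "to_global T p x = p + T x"

type_synonym algorithm = "point multiset \<Rightarrow> point"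

definition snapshot :: "(point \<Rightarrow> point) \<Rightarrow> point \<Rightarrow> configuration \<Rightarrow> point multiset" where
  "snapshot T p C = image_mset (to_local T p) (mset C)"

definition fsync_step ::
  "algorithm \<Rightarrow> (nat \<Rightarrow> point \<Rightarrow> point) \<Rightarrow> configuration \<Rightarrow> configuration" where
  "fsync_step A Z C =
     map (\<lambda>i. to_global (Z i) (C ! i) (A (snapshot (Z i) (C ! i) C))) [0..<length C]"

definition run ::
  "algorithm \<Rightarrow> (nat \<Rightarrow> point \<Rightarrow> point) \<Rightarrow> configuration \<Rightarrow> nat \<Rightarrow> configuration" where
  "run A Z C\<^sub>0 j = (fsync_step A Z ^^ j) C\<^sub>0"

definition fixpoint_free_perms :: "nat \<Rightarrow> (nat \<Rightarrow> nat) set" where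
  "fixpoint_free_perms n = {\<pi>. \<pi> permutes {..<n} \<and> (\<forall>i<n. \<pi> i \<noteq> i)}"

definition solves_move_all :: "algorithm \<Rightarrow> nat \<Rightarrow> configuration \<Rightarrow> bool" where
  "solves_move_all A k C\<^sub>0 \<longleftrightarrow>
     (\<forall>Z. (\<forall>i<length C\<^sub>0. coordinate_system (Z i)) \<longrightarrow>
        (\<forall>j. \<exists>\<pi>\<in>fixpoint_free_perms (length C\<^sub>0).
           \<forall>i. run A Z C\<^sub>0 (j + i * k) = permute_list (\<pi> ^^ i) (run A Z C\<^sub>0 j)))"

definition move_all_solvable :: "nat \<Rightarrow> configuration \<Rightarrow> bool" where
  "move_all_solvable k C\<^sub>0 \<longleftrightarrow> (\<exists>A. solves_move_all A k C\<^sub>0)"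

definition smallest_enclosing_circle :: "point set \<Rightarrow> point \<Rightarrow> real \<Rightarrow> bool" where
  "smallest_enclosing_circle S c r \<longleftrightarrow>
     S \<subseteq> cball c r \<and> (\<forall>c' r'. S \<subseteq> cball c' r' \<longrightarrow> r \<le> r')"

definition rotation_about :: "point \<Rightarrow> real \<Rightarrow> point \<Rightarrow> point" where
  "rotation_about c \<phi> z = c + cis \<phi> * (z - c)"

definition centred_symmetric_configs :: "configuration set" where
  "centred_symmetric_configs =
     {C. \<exists>c r. smallest_enclosing_circle (set C) c r \<and>
           (\<exists>!i. i < length C \<and> C ! i = c) \<and>
           (\<exists>k::nat. k > 1 \<and>
              image_mset (rotation_about c (2 * pi / real k)) (mset C) = mset C)}"

text \<open>The line through \<open>a\<close> with normal vector \<open>v \<noteq> 0\<close>, and the reflection in it.\<close>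

definition line :: "point \<Rightarrow> point \<Rightarrow> point set" where
  "line a v = {z. (z - a) \<bullet> v = 0}"

definition reflection :: "point \<Rightarrow> point \<Rightarrow> point \<Rightarrow> point" where
  "reflection a v z = z - (2 * ((z - a) \<bullet> v) / (v \<bullet> v)) *\<^sub>R v"

definition axis_of_symmetry :: "point set \<Rightarrow> point set \<Rightarrow> bool" where
  "axis_of_symmetry S L \<longleftrightarrow>
     (\<exists>a v. v \<noteq> 0 \<and> L = line a v \<and> reflection a v ` S = S)"

end

theory Submission
  imports Defs
begin

text \<open>
  Suppose an algorithm solves the problem in two steps. Give all robots the coordinate system
  \<open>T\<close>, except robot \<open>c\<close>, which gets \<open>S\<close>. Since \<open>C\<^sub>2\<close> is a rearrangement of \<open>C\<^sub>0\<close> in which \<open>c\<close>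
  stands at the old place of some \<open>q \<noteq> c\<close>, comparing \<open>C\<^sub>3\<close> with \<open>C\<^sub>1\<close> shows that either the
  first move from the place of \<open>c\<close> is the same under \<open>S\<close> and \<open>T\<close>, or the robots \<open>c\<close> and \<open>q\<close> would
  meet if both had \<open>T\<close>. After such a meeting they could never separate again, so
  \<open>C\<^sub>1\<close> does not depend on the coordinate systems at all, and hence inherits
  every symmetry \<open>\<phi>\<close> of \<open>C\<^sub>0\<close>.

  Now let \<open>\<phi>\<close> fix the position of exactly one robot \<open>c\<close>. In \<open>C\<^sub>2\<close> that position is occupied by
  some \<open>d \<noteq> c\<close>. Let \<open>e \<noteq> d\<close> be the robot standing at the \<open>\<phi>\<close>-image of \<open>d\<close> in \<open>C\<^sub>0\<close>. Giving \<open>e\<close> the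
  \<open>\<phi>\<close>-image of the coordinate system of \<open>d\<close> changes neither \<open>C\<^sub>1\<close> nor the second move of \<open>d\<close>, but
  sends \<open>e\<close> to the same point as \<open>d\<close>, which is impossible.
\<close>

section \<open>Moves, coordinate systems and isometries\<close>

definition destination ::
  "algorithm \<Rightarrow> (point \<Rightarrow> point) \<Rightarrow> point \<Rightarrow> point multiset \<Rightarrow> point" where
  "destination A T p M = to_global T p (A (image_mset (to_local T p) M))"

lemma length_fsync_step [simp]: "length (fsync_step A Z C) = length C"
  by (simp add: fsync_step_def)

lemma nth_fsync_step:
  "i < length C \<Longrightarrow> fsync_step A Z C ! i = destination A (Z i) (C ! i) (mset C)"
  by (simp add: fsync_step_def destination_def snapshot_def)

lemma mset_eq_image_nth: "mset C = image_mset ((!) C) (mset_set {..<length C})"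
  by (metis map_nth mset_map mset_upt atLeast0LessThan)

lemma coordinate_system_id: "coordinate_system (\<lambda>x. x)"
  unfolding coordinate_system_def
  by (rule exI[of _ 1])
    (auto intro!: exI[of _ "\<lambda>x. x"] orthogonal_transformation_id[unfolded id_def])

lemma coordinate_system_inj: "coordinate_system T \<Longrightarrow> inj T"
  unfolding coordinate_system_def
  by (auto intro!: injI dest!: orthogonal_transformation_inj simp: inj_eq)

lemma coordinate_system_compose:
  assumes "orthogonal_transformation R" "coordinate_system T"
  shows "coordinate_system (R \<circ> T)"
proof -
  obtain u Q where "u > 0" "orthogonal_transformation Q" and T: "T = (\<lambda>x. u *\<^sub>R Q x)"
    using assms(2) unfolding coordinate_system_def by auto
  moreover have "R \<circ> T = (\<lambda>x. u *\<^sub>R (R \<circ> Q) x)"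
    using assms(1) by (auto simp: T orthogonal_transformation_def linear_scale)
  ultimately show ?thesis
    using assms(1) orthogonal_transformation_compose unfolding coordinate_system_def by blast
qed

text \<open>Local coordinates cancel \<open>\<phi>\<close>: the observer at \<open>\<phi> p\<close>
  with \<open>R \<circ> T\<close> sees the same local snapshot as the one at \<open>p\<close> with
  \<open>T\<close>, so \<open>A\<close> returns the same answer. \<open>R\<close> may reverse
  handedness, which is admissible without chirality.\<close>

lemma destination_equivariant:
  assumes R: "orthogonal_transformation R" and T: "coordinate_system T"
    and \<phi>: "\<And>x y. \<phi> x - \<phi> y = R (x - y)"
  shows "destination A (R \<circ> T) (\<phi> p) (image_mset \<phi> M) = \<phi> (destination A T p M)"
proof -
  have "inj R" "inj T"
    using R T by (auto simp: orthogonal_transformation_inj coordinate_system_inj)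
  have "surj T"
  proof -
    obtain u Q where "u > 0" "orthogonal_transformation Q" and T_eq: "T = (\<lambda>x. u *\<^sub>R Q x)"
      using T unfolding coordinate_system_def by blast
    have "T (inv Q ((1 / u) *\<^sub>R y)) = y" for y
      using \<open>u > 0\<close> \<open>orthogonal_transformation Q\<close>
      by (simp add: T_eq surj_f_inv_f orthogonal_transformation_surj)
    then show ?thesis
      by (rule surjI)
  qed
  have "to_local (R \<circ> T) (\<phi> p) (\<phi> q) = to_local T p q" for q
  proof -
    have "\<phi> q - \<phi> p = (R \<circ> T) (inv T (q - p))"
      using \<open>surj T\<close> by (simp add: \<phi> surj_f_inv_f)
    then show ?thesis
      unfolding to_local_def using \<open>inj R\<close> \<open>inj T\<close> inj_compose inv_f_f by metis
  qed
  moreover have "to_global (R \<circ> T) (\<phi> p) x = \<phi> (to_global T p x)" for x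
    using \<phi>[of "p + T x" p] by (simp add: to_global_def algebra_simps)
  ultimately show ?thesis
    by (simp add: destination_def multiset.map_comp o_def)
qed

section \<open>Consequences of solvability in two steps\<close>

lemma solves_move_all_2D:
  assumes "solves_move_all A 2 C" and "\<And>i. coordinate_system (Z i)"
  obtains \<pi> where "\<pi> permutes {..<length C}" "\<And>i. i < length C \<Longrightarrow> \<pi> i \<noteq> i"
    and "fsync_step A Z (fsync_step A Z C) = permute_list \<pi> C"
    and "mset (fsync_step A Z (permute_list \<pi> C)) = mset (fsync_step A Z C)"
proof -
  have run: "\<exists>\<pi>\<in>fixpoint_free_perms (length C).
      \<forall>i. run A Z C (j + i * 2) = permute_list (\<pi> ^^ i) (run A Z C j)" for j
    using assms unfolding solves_move_all_def by blast
  obtain \<pi> where \<pi>: "\<pi> \<in> fixpoint_free_perms (length C)"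
    and "\<And>i. run A Z C (0 + i * 2) = permute_list (\<pi> ^^ i) (run A Z C 0)"
    using run[of 0] by blast
  from this(2)[of 1] have C2: "fsync_step A Z (fsync_step A Z C) = permute_list \<pi> C"
    by (simp add: run_def numeral_2_eq_2)
  obtain \<rho> where \<rho>: "\<rho> \<in> fixpoint_free_perms (length C)"
    and "\<And>i. run A Z C (1 + i * 2) = permute_list (\<rho> ^^ i) (run A Z C 1)"
    using run[of 1] by blast
  from this(2)[of 1] have "fsync_step A Z (permute_list \<pi> C) = permute_list \<rho> (fsync_step A Z C)"
    using C2 by (simp add: run_def numeral_3_eq_3)
  \<comment> \<open>Passing to multisets eliminates \<open>\<rho>\<close>, about whose relation to
    \<open>\<pi>\<close> nothing is known.\<close>
  with \<rho> have "mset (fsync_step A Z (permute_list \<pi> C)) = mset (fsync_step A Z C)"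
    by (simp add: fixpoint_free_perms_def)
  with \<pi> C2 that show thesis
    by (auto simp: fixpoint_free_perms_def)
qed

text \<open>This is what rules out meetings: two robots sent to the same point in the second round
  give a contradiction.\<close>

lemma solves_move_all_2_distinct:
  assumes "solves_move_all A 2 C" "distinct C" and "\<And>i. coordinate_system (Z i)"
  shows "distinct (fsync_step A Z (fsync_step A Z C))"
proof (rule solves_move_all_2D[OF assms(1,3)])
  fix \<pi>
  assume "\<pi> permutes {..<length C}" "fsync_step A Z (fsync_step A Z C) = permute_list \<pi> C"
  then show ?thesis
    using assms(2) by (simp add: distinct_permute_list)
qed

lemma first_move_independent:
  assumes sol: "solves_move_all A 2 C" and "distinct C" and c: "c < length C"
    and S: "coordinate_system S" and T: "coordinate_system T"
  shows "destination A S (C ! c) (mset C) = destination A T (C ! c) (mset C)"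
proof (rule ccontr)
  \<comment> \<open>Indexed by the place, not by the robot: any robot at \<open>C ! i\<close> with
    system \<open>U\<close> goes to \<open>f i U\<close>, as long as the multiset of positions is
    that of \<open>C\<close>.\<close>
  define f where "f i U = destination A U (C ! i) (mset C)" for i U
  assume "\<not> ?thesis"
  then have neq: "f c S \<noteq> f c T"
    by (simp add: f_def)
  let ?I = "mset_set {..<length C}"
  define Z where "Z = (\<lambda>_. T)(c := S)"
  have "coordinate_system (Z i)" for i
    using S T by (simp add: Z_def)
  then obtain \<pi> where \<pi>: "\<pi> permutes {..<length C}" and fpf: "\<And>i. i < length C \<Longrightarrow> \<pi> i \<noteq> i"
    and mset3: "mset (fsync_step A Z (permute_list \<pi> C)) = mset (fsync_step A Z C)"
    using solves_move_all_2D[OF sol] by metis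
  define q where "q = \<pi> c"
  have q: "q < length C" "q \<noteq> c"
    using c fpf permutes_in_image[OF \<pi>] by (auto simp: q_def)
  have "mset (fsync_step A Z C) = image_mset (\<lambda>i. f i (Z i)) ?I"
    unfolding mset_eq_image_nth[of "fsync_step A Z C"]
    by (auto intro!: image_mset_cong simp: nth_fsync_step f_def)
  also have "\<dots> = image_mset ((\<lambda>i. f i T)(c := f c S)) ?I"
    by (auto intro!: image_mset_cong simp: Z_def)
  finally have M1: "mset (fsync_step A Z C) = image_mset ((\<lambda>i. f i T)(c := f c S)) ?I" .
  have "mset (fsync_step A Z (permute_list \<pi> C)) = image_mset (\<lambda>i. f (\<pi> i) (Z i)) ?I"
    unfolding mset_eq_image_nth[of "fsync_step A Z (permute_list \<pi> C)"]
    by (auto intro!: image_mset_cong simp: nth_fsync_step f_def permute_list_nth[OF \<pi>] \<pi>)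
  \<comment> \<open>Reindexing by places: in the third round \<open>S\<close> is used at the place
    of \<open>q\<close>, and \<open>T\<close> at all others.\<close>
  also have "\<dots> = image_mset ((\<lambda>i. f i T)(q := f q S)) (image_mset \<pi> ?I)"
    unfolding multiset.map_comp
    by (auto intro!: image_mset_cong simp: Z_def q_def inj_eq[OF permutes_inj[OF \<pi>]])
  also have "image_mset \<pi> ?I = ?I"
    using \<pi> by (simp add: image_mset_mset_set permutes_inj_on permutes_image)
  finally have M3: "mset (fsync_step A Z (permute_list \<pi> C)) =
      image_mset ((\<lambda>i. f i T)(q := f q S)) ?I" .
  \<comment> \<open>Changing one value exchanges one element; the additive form avoids multiset
    subtraction.\<close>
  have upd: "image_mset (g(j := y)) ?I + {#g j#} = image_mset g ?I + {#y#}"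
    if "j < length C" for g :: "nat \<Rightarrow> point" and j y
  proof -
    have "?I = add_mset j (mset_set ({..<length C} - {j}))"
      using that by (metis finite_lessThan lessThan_iff mset_set.remove)
    moreover have "image_mset (g(j := y)) (mset_set ({..<length C} - {j})) =
        image_mset g (mset_set ({..<length C} - {j}))"
      by (auto intro!: image_mset_cong)
    ultimately show ?thesis
      by simp
  qed
  let ?N = "mset (fsync_step A Z C)" and ?M = "image_mset (\<lambda>i. f i T) ?I"
  have "?N + {#f c T#} = ?M + {#f c S#}"
    using upd[OF c, of "\<lambda>i. f i T" "f c S"] by (simp only: M1)
  moreover have "?N + {#f q T#} = ?M + {#f q S#}"
    using upd[OF q(1), of "\<lambda>i. f i T" "f q S"] by (simp only: M3 flip: mset3)
  \<comment> \<open>\<open>?N\<close> arises from \<open>?M\<close> by an exchange at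
    \<open>c\<close> and also by one at \<open>q\<close>; eliminating \<open>?N\<close> and
    cancelling \<open>?M\<close> leaves an equation of pairs.\<close>
  ultimately have "?M + {#f c S#} + {#f q T#} = ?M + {#f q S#} + {#f c T#}"
    by (metis add.assoc add.commute)
  then have "{#f c S, f q T#} = {#f q S, f c T#}"
    by (simp add: add_mset_commute)
  with neq have meet: "f c T = f q T"
    by (auto simp: add_eq_conv_ex)
  \<comment> \<open>Having met in \<open>?C1\<close> with the same system \<open>T\<close>, robots
    \<open>c\<close> and \<open>q\<close> make the same second move.\<close>
  let ?C1 = "fsync_step A (\<lambda>_. T) C"
  have "?C1 ! c = ?C1 ! q"
    using c q meet by (simp add: nth_fsync_step f_def)
  then have "fsync_step A (\<lambda>_. T) ?C1 ! c = fsync_step A (\<lambda>_. T) ?C1 ! q"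
    using c q by (simp add: nth_fsync_step)
  moreover have "distinct (fsync_step A (\<lambda>_. T) ?C1)"
    by (rule solves_move_all_2_distinct[OF sol \<open>distinct C\<close> T])
  ultimately show False
    using c q by (simp add: nth_eq_iff_index_eq)
qed

section \<open>Contradiction from an isometry fixing the place of exactly one robot\<close>

lemma not_move_all_solvable_2_if_unique_fixed_robot:
  assumes "distinct C" and R: "orthogonal_transformation R"
    and \<phi>: "\<And>x y. \<phi> x - \<phi> y = R (x - y)" and img: "\<phi> ` set C = set C"
    and c: "c < length C" and fix_c: "\<phi> (C ! c) = C ! c"
    and unique: "\<And>i. i < length C \<Longrightarrow> \<phi> (C ! i) = C ! i \<Longrightarrow> i = c"
  shows "\<not> move_all_solvable 2 C"
proof
  assume "move_all_solvable 2 C"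
  then obtain A where sol: "solves_move_all A 2 C"
    unfolding move_all_solvable_def by blast
  define T :: "point \<Rightarrow> point" where "T = (\<lambda>x. x)"
  have T: "coordinate_system T"
    unfolding T_def by (rule coordinate_system_id)
  have RT: "coordinate_system (R \<circ> T)"
    by (rule coordinate_system_compose[OF R T])
  define C1 where "C1 = fsync_step A (\<lambda>_. T) C"
  have C1_indep: "fsync_step A Z C = C1" if "\<And>i. coordinate_system (Z i)" for Z
    using first_move_independent[OF sol \<open>distinct C\<close> _ that T]
    by (auto intro!: nth_equalityI simp: C1_def nth_fsync_step)
  have "inj \<phi>"
    using R \<phi> by (metis injI orthogonal_transformation_inj inj_eq eq_iff_diff_eq_0)
  then have mset_C: "image_mset \<phi> (mset C) = mset C"
    using img \<open>distinct C\<close>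
    by (metis image_mset_mset_set inj_on_subset mset_set_set subset_UNIV)
  define first where "first p = destination A T p (mset C)" for p
  have C1_map: "C1 = map first C"
    by (auto intro!: nth_equalityI simp: C1_def nth_fsync_step first_def)
  have first_sym: "first (\<phi> p) = \<phi> (first p)" if "p \<in> set C" for p
  proof -
    have "\<phi> p \<in> set C"
      using img that by blast
    then obtain i where "i < length C" "C ! i = \<phi> p"
      by (auto simp: in_set_conv_nth)
    \<comment> \<open>Independence of the first move allows \<open>T\<close> to be replaced by
      \<open>R \<circ> T\<close> at \<open>\<phi> p\<close>, the form that equivariance
      requires.\<close>
    then have "first (\<phi> p) = destination A (R \<circ> T) (\<phi> p) (mset C)"
      using first_move_independent[OF sol \<open>distinct C\<close> _ T RT, of i] by (simp add: first_def)
    also have "\<dots> = \<phi> (first p)"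
      using destination_equivariant[OF R T \<phi>, of A p "mset C"] by (simp add: mset_C first_def)
    finally show ?thesis .
  qed
  have "image_mset \<phi> (mset C1) = image_mset (\<lambda>p. \<phi> (first p)) (mset C)"
    by (simp add: C1_map multiset.map_comp o_def)
  also have "\<dots> = image_mset first (image_mset \<phi> (mset C))"
    unfolding multiset.map_comp by (auto intro!: image_mset_cong simp: first_sym)
  \<comment> \<open>The snapshot of the second round is thus also symmetric, so equivariance applies
    to the second move of \<open>e\<close>.\<close>
  finally have mset_C1: "image_mset \<phi> (mset C1) = mset C1"
    by (simp add: mset_C C1_map)

  obtain \<pi> where \<pi>: "\<pi> permutes {..<length C}" and fpf: "\<And>i. i < length C \<Longrightarrow> \<pi> i \<noteq> i"
    and C2: "fsync_step A (\<lambda>_. T) C1 = permute_list \<pi> C"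
    using solves_move_all_2D[OF sol, of "\<lambda>_. T"] T unfolding C1_def by metis
  obtain d where d: "d < length C" "\<pi> d = c"
    using c permutes_image[OF \<pi>] by (metis imageE lessThan_iff)
  then have "d \<noteq> c"
    using fpf by blast
  have len: "length C1 = length C"
    by (simp add: C1_def)
  have d_dest: "destination A T (C1 ! d) (mset C1) = C ! c"
    using C2 d nth_fsync_step[of d C1 A "\<lambda>_. T"] by (simp add: len permute_list_nth[OF \<pi>])
  have "\<phi> (C ! d) \<in> set C"
    using d img nth_mem by blast
  then obtain e where e: "e < length C" "C ! e = \<phi> (C ! d)"
    by (auto simp: in_set_conv_nth)
  \<comment> \<open>Otherwise \<open>\<phi>\<close> would fix the place of \<open>d\<close>, forcing
    \<open>d = c\<close>.\<close>
  have "e \<noteq> d"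
    using unique[OF d(1)] e \<open>d \<noteq> c\<close> by metis
  define Z where "Z = (\<lambda>_. T)(e := R \<circ> T)"
  have Z: "coordinate_system (Z i)" for i
    using T RT by (simp add: Z_def)
  have "C1 ! e = \<phi> (C1 ! d)"
    using d e by (simp add: C1_map first_sym)
  \<comment> \<open>The target of \<open>e\<close> is the \<open>\<phi>\<close>-image of the target
    of \<open>d\<close>, and that target \<open>C ! c\<close> is fixed by
    \<open>\<phi>\<close>.\<close>
  then have "destination A (R \<circ> T) (C1 ! e) (mset C1) = C ! c"
    using destination_equivariant[OF R T \<phi>, of A "C1 ! d" "mset C1"] d_dest
    by (simp add: mset_C1 fix_c)
  then have "fsync_step A Z C1 ! e = fsync_step A Z C1 ! d"
    using d e \<open>e \<noteq> d\<close> d_dest by (simp add: nth_fsync_step len Z_def)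
  moreover have "distinct (fsync_step A Z C1)"
    using solves_move_all_2_distinct[OF sol \<open>distinct C\<close> Z] C1_indep[OF Z] by simp
  ultimately show False
    using d e \<open>e \<noteq> d\<close> by (simp add: nth_eq_iff_index_eq len)
qed

section \<open>Rotations and reflections\<close>

lemma cis_two_pi_divide_neq_1:
  assumes "k > 1"
  shows "cis (2 * pi / real k) \<noteq> 1"
proof
  assume "cis (2 * pi / real k) = 1"
  then have "cos (2 * pi / real k) = 1"
    by (metis cis.sel(1) one_complex.sel(1))
  then obtain m :: int where "2 * pi / real k = of_int m * (2 * pi)"
    using cos_one_2pi_int by auto
  then have "real_of_int m * real k = 1"
    using assms by (simp add: field_simps)
  then have "m * int k = 1"
    by (metis of_int_eq_1_iff of_int_mult of_int_of_nat_eq)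
  with assms show False
    by (simp add: zmult_eq_1_iff)
qed

lemma orthogonal_transformation_reflection:
  assumes "v \<noteq> 0"
  shows "orthogonal_transformation (reflection 0 v)"
proof -
  define k where "k = 2 / (v \<bullet> v)"
  have k: "k * (v \<bullet> v) = 2"
    using assms by (simp add: k_def)
  have eq: "reflection 0 v x = x - (k * (x \<bullet> v)) *\<^sub>R v" for x
    by (simp add: reflection_def k_def)
  have "linear (reflection 0 v)"
  proof (rule linearI)
    show "reflection 0 v (x + y) = reflection 0 v x + reflection 0 v y" for x y
      unfolding eq inner_add_left distrib_left scaleR_add_left by simp
    show "reflection 0 v (r *\<^sub>R x) = r *\<^sub>R reflection 0 v x" for r x
      unfolding eq inner_scaleR_left scaleR_diff_right scaleR_scaleR mult.left_commute[of k r] ..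
  qed
  moreover have "reflection 0 v x \<bullet> reflection 0 v y = x \<bullet> y" for x y
  proof -
    \<comment> \<open>The factor \<open>k * (v \<bullet> v)\<close> is kept apart so that replacing
      it by 2 cancels the last two terms.\<close>
    have "reflection 0 v x \<bullet> reflection 0 v y =
        x \<bullet> y - 2 * k * (x \<bullet> v) * (y \<bullet> v) + k * (x \<bullet> v) * (y \<bullet> v) * (k * (v \<bullet> v))"
      unfolding eq inner_diff_left inner_diff_right inner_scaleR_left inner_scaleR_right
        inner_commute[of v y] by algebra
    then show ?thesis
      unfolding k by simp
  qed
  ultimately show ?thesis
    unfolding orthogonal_transformation_def by blast
qed

theorem theorem13:
  fixes n :: nat and C\<^sub>0 :: configuration
  assumes "n \<ge> 2" and "length C\<^sub>0 = n" and "distinct C\<^sub>0"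
    and "C\<^sub>0 \<in> centred_symmetric_configs \<or>
         (\<exists>L. axis_of_symmetry (set C\<^sub>0) L \<and> (\<exists>!i. i < n \<and> C\<^sub>0 ! i \<in> L))"
  shows "\<not> move_all_solvable 2 C\<^sub>0"
  using assms(4)
proof
  assume "C\<^sub>0 \<in> centred_symmetric_configs"
  then obtain z k where uniq: "\<exists>!i. i < length C\<^sub>0 \<and> C\<^sub>0 ! i = z" and "k > (1 :: nat)"
    and inv: "image_mset (rotation_about z (2 * pi / real k)) (mset C\<^sub>0) = mset C\<^sub>0"
    unfolding centred_symmetric_configs_def by blast
  define w where "w = cis (2 * pi / real k)"
  have "w \<noteq> 1" "norm w = 1"
    using cis_two_pi_divide_neq_1[OF \<open>k > 1\<close>] by (simp_all add: w_def)
  \<comment> \<open>The displacement of \<open>p\<close> is \<open>(w - 1) * (p - z)\<close>, which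
    vanishes only at the centre since \<open>w \<noteq> 1\<close>.\<close>
  have fixed: "rotation_about z (2 * pi / real k) p = p \<longleftrightarrow> p = z" for p
  proof -
    have "rotation_about z (2 * pi / real k) p - p = (w - 1) * (p - z)"
      by (simp add: rotation_about_def w_def algebra_simps)
    then show ?thesis
      using \<open>w \<noteq> 1\<close> by (metis eq_iff_diff_eq_0 mult_eq_0_iff)
  qed
  obtain c where c: "c < length C\<^sub>0" "C\<^sub>0 ! c = z"
    using uniq by blast
  show ?thesis
  proof (rule not_move_all_solvable_2_if_unique_fixed_robot[OF assms(3)])
    show "orthogonal_transformation ((*) w)"
      using \<open>norm w = 1\<close>
      by (auto simp: orthogonal_transformation norm_mult intro!: linear_times)
    show "rotation_about z (2 * pi / real k) x - rotation_about z (2 * pi / real k) y = w * (x - y)"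
      for x y
      by (simp add: rotation_about_def w_def algebra_simps)
    show "rotation_about z (2 * pi / real k) ` set C\<^sub>0 = set C\<^sub>0"
      using arg_cong[OF inv, of set_mset] by simp
  qed (use c uniq fixed in auto)
next
  assume "\<exists>L. axis_of_symmetry (set C\<^sub>0) L \<and> (\<exists>!i. i < n \<and> C\<^sub>0 ! i \<in> L)"
  then obtain a v where "v \<noteq> 0" and img: "reflection a v ` set C\<^sub>0 = set C\<^sub>0"
    and uniq: "\<exists>!i. i < n \<and> C\<^sub>0 ! i \<in> line a v"
    unfolding axis_of_symmetry_def by blast
  have fixed: "reflection a v p = p \<longleftrightarrow> p \<in> line a v" for p
    using \<open>v \<noteq> 0\<close> by (simp add: reflection_def line_def)
  obtain c where c: "c < n" "C\<^sub>0 ! c \<in> line a v"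
    using uniq by blast
  show ?thesis
  proof (rule not_move_all_solvable_2_if_unique_fixed_robot[OF assms(3)])
    show "orthogonal_transformation (reflection 0 v)"
      by (rule orthogonal_transformation_reflection[OF \<open>v \<noteq> 0\<close>])
    show "reflection a v x - reflection a v y = reflection 0 v (x - y)" for x y
      by (simp add: reflection_def inner_diff_left algebra_simps diff_divide_distrib)
    show "reflection a v ` set C\<^sub>0 = set C\<^sub>0"
      by (rule img)
  qed (use c uniq fixed assms(2) in auto)
qed

end
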